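(* Let $n,m$ be integers for which there exist integers $d$, $k_1\ge 1$ and $k_2\ge 1$ with $$m = k_1 n + d,\qquad n > d > 1,\qquad n = k_2 d.$$ Then there exists an extremal array in $\mathcal{M}(n,m)$ that is not minimum.
   Context: For positive integers $n,m$, an $n\times m$ real array $A=(a_{i,j})$ with all $a_{i,j}\ge 0$ is called doubly stochastic (with uniform marginals) if $\sum_{i=1}^n a_{i,j}=n$ for every column $j=1,\dots,m$ and $\sum_{j=1}^m a_{i,j}=m$ for every row $i=1,\dots,n$. The set of all such arrays is denoted $\mathcal{M}(n,m)$; it is a convex set. An array $M\in\mathcal{M}(n,m)$ is extremal if it is an extreme point of the convex set $\mathcal{M}(n,m)$, i.e. it cannot be written as a convex combination of elements of $\mathcal{M}(n,m)$ different from $M$. The support $\operatorname{supp} A$ is the set of positions $(i,j)$ with $a_{i,j}\neq 0$, and $|\operatorname{supp} A|$ is its cardinality. Define $S(n,m)=\min\{|\operatorname{supp} A| : A\in\mathcal{M}(n,m)\}$. An array $M\in\mathcal{M}(n,m)$ is called minimum if $|\operatorname{supp} M|=S(n,m)$. *)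

theory Defs
  imports "HOL-Analysis.Analysis"
begin

text \<open>An \<open>n \<times> m\<close> real array is an element of \<^typ>\<open>real ^ 'm ^ 'n\<close> with \<open>CARD('n) = n\<close> and
  \<open>CARD('m) = m\<close>, so that \<open>A $ i $ j\<close> is the entry in row \<open>i\<close> and column \<open>j\<close>. The marginals are
  scaled: columns sum to \<open>n\<close> and rows sum to \<open>m\<close>.\<close>

definition doubly_stochastic :: "(real ^ 'm ^ 'n) set" where
  "doubly_stochastic =
    {A. (\<forall>i j. 0 \<le> A $ i $ j) \<and>
        (\<forall>j. (\<Sum>i\<in>UNIV. A $ i $ j) = real CARD('n)) \<and>
        (\<forall>i. (\<Sum>j\<in>UNIV. A $ i $ j) = real CARD('m))}"

definition supp :: "real ^ 'm ^ 'n \<Rightarrow> ('n \<times> 'm) set" where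
  "supp A = {(i, j). A $ i $ j \<noteq> 0}"

text \<open>The number \<open>S(n,m)\<close>. The infimum is over a nonempty set of natural numbers, hence a minimum;
  see \<open>min_supp_attained\<close> below.\<close>

definition min_supp :: "'n::finite itself \<Rightarrow> 'm::finite itself \<Rightarrow> nat" where
  "min_supp _ _ = (INF A \<in> (doubly_stochastic :: (real ^ 'm ^ 'n) set). card (supp A))"

definition minimum_array :: "real ^ 'm ^ 'n \<Rightarrow> bool" where
  "minimum_array M \<longleftrightarrow>
    M \<in> doubly_stochastic \<and> card (supp M) = min_supp TYPE('n) TYPE('m)"

lemma doubly_stochastic_nonempty: "(doubly_stochastic :: (real ^ 'm ^ 'n) set) \<noteq> {}"
proof -
  have "(\<chi> i j. 1) \<in> (doubly_stochastic :: (real ^ 'm ^ 'n) set)"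
    by (simp add: doubly_stochastic_def)
  then show ?thesis by blast
qed

lemma min_supp_attained:
  "\<exists>A \<in> (doubly_stochastic :: (real ^ 'm ^ 'n) set). card (supp A) = min_supp TYPE('n) TYPE('m)"
proof -
  have "min_supp TYPE('n) TYPE('m) \<in>
      (\<lambda>A. card (supp A)) ` (doubly_stochastic :: (real ^ 'm ^ 'n) set)"
    unfolding min_supp_def by (rule Inf_nat_def1) (simp add: doubly_stochastic_nonempty)
  then show ?thesis by force
qed

lemma min_supp_le:
  fixes A :: "real ^ 'm ^ 'n"
  assumes "A \<in> doubly_stochastic"
  shows "min_supp TYPE('n) TYPE('m) \<le> card (supp A)"
  unfolding min_supp_def using assms by (intro cINF_lower) auto

lemma convex_doubly_stochastic: "convex (doubly_stochastic :: (real ^ 'm ^ 'n) set)"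
  by (auto simp: convex_def doubly_stochastic_def sum.distrib
      simp flip: sum_distrib_left distrib_right)

end

theory Submission imports Defs begin

text \<open>Read an array as a bipartite graph whose edges are the positions of its support. An array is
  extremal as soon as its support carries no nonzero perturbation with vanishing row and column
  sums (lemma \<open>extreme_point_if_rigid\<close>), which is the case for every forest; a forest with
  \<open>c\<close> components has \<open>n + m - c\<close> edges. So it suffices to find two forests with different numbers
  of components.

  Since \<open>m = k1 * n + d\<close>, give every row \<open>k1\<close> private columns, each filled by a single entry \<open>n\<close>.
  Every row is left with mass \<open>d\<close>, and as \<open>n = k2 * d\<close> the rows can be divided into \<open>d\<close> blocks
  of \<open>k2\<close> rows, the rows of a block sharing one further column. This is \<open>block_array\<close>, with one
  component for each block.

  Now move mass \<open>d\<close> around the rectangle spanned by the rows \<open>0\<close> and \<open>1\<close>, which lie in different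
  blocks because \<open>d > 1\<close>, by a private column of row \<open>0\<close> and the shared column of row \<open>1\<close>. The
  entry \<open>n\<close> becomes \<open>n - d > 0\<close> and survives, the entry \<open>d\<close> of row \<open>1\<close> disappears, and two new
  entries \<open>d\<close> appear. The resulting \<open>switched_array\<close> therefore has one more entry in its support
  than \<open>block_array\<close>, and is not minimum. Its two merged blocks form a single tree, so it is
  extremal (\<open>switched_rigid\<close>).\<close>

section \<open>Rigid supports\<close>

text \<open>If the array is a proper convex combination of \<open>a\<close> and \<open>b\<close>, nonnegativity forces both to vanish
  wherever it does, so \<open>a - b\<close> is a perturbation of the forbidden kind.\<close>

lemma extreme_point_if_rigid:
  fixes M :: "real ^ 'm ^ 'n"
  assumes M: "M \<in> doubly_stochastic"
    and rigid: "\<And>D :: real ^ 'm ^ 'n.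
      \<lbrakk>\<And>i j. M $ i $ j = 0 \<Longrightarrow> D $ i $ j = 0; \<And>i. (\<Sum>j\<in>UNIV. D $ i $ j) = 0;
        \<And>j. (\<Sum>i\<in>UNIV. D $ i $ j) = 0\<rbrakk> \<Longrightarrow> D = 0"
  shows "M extreme_point_of doubly_stochastic"
  unfolding extreme_point_of_def
proof (intro conjI ballI notI)
  fix a b :: "real ^ 'm ^ 'n"
  assume a: "a \<in> doubly_stochastic" and b: "b \<in> doubly_stochastic" and "M \<in> open_segment a b"
  then obtain u where "a \<noteq> b" and u: "0 < u" "u < 1" and eq: "M = (1 - u) *\<^sub>R a + u *\<^sub>R b"
    by (auto simp: in_segment)
  have "a - b = 0"
  proof (rule rigid)
    fix i j
    assume "M $ i $ j = 0"
    then have "(1 - u) * a $ i $ j + u * b $ i $ j = 0"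
      using eq by simp
    moreover have "0 \<le> (1 - u) * a $ i $ j" "0 \<le> u * b $ i $ j"
      using a b u by (auto simp: doubly_stochastic_def)
    ultimately have "(1 - u) * a $ i $ j = 0" "u * b $ i $ j = 0"
      by linarith+
    then show "(a - b) $ i $ j = 0"
      using u by simp
  qed (use a b in \<open>simp_all add: doubly_stochastic_def sum_subtractf\<close>)
  with \<open>a \<noteq> b\<close> show False by simp
qed (rule M)

lemma zero_sum_single_support:
  fixes f :: "'a \<Rightarrow> 'b::comm_monoid_add"
  assumes "finite S" "sum f S = 0" "a \<in> S" "\<And>x. x \<in> S \<Longrightarrow> x \<noteq> a \<Longrightarrow> f x = 0"
  shows "f a = 0"
proof -
  have "sum f S = f a + sum f (S - {a})"
    using assms by (simp add: sum.remove)
  moreover have "sum f (S - {a}) = 0"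
    using assms by (intro sum.neutral) auto
  ultimately show ?thesis
    using assms by simp
qed

section \<open>The two arrays\<close>

text \<open>Private columns and blocks are both assigned by remainders, so that one lemma on periodic sums
  gives the row sums and the column sums, and rows \<open>0\<close> and \<open>1\<close> fall into different blocks.\<close>

definition block_array :: "nat \<Rightarrow> nat \<Rightarrow> nat \<Rightarrow> nat \<Rightarrow> nat \<Rightarrow> real" where
  "block_array n k1 d x y =
    (if y < k1 * n then if y mod n = x then real n else 0
     else if x mod d = y - k1 * n then real d else 0)"

text \<open>The switch around a rectangle is the product of two signed indicators. Both have sum zero, so
  it leaves all marginals unchanged.\<close>

definition signed_pair :: "nat \<Rightarrow> nat \<Rightarrow> nat \<Rightarrow> real" where
  "signed_pair a b z = (if z = a then -1 else if z = b then 1 else 0)"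

definition switched_array :: "nat \<Rightarrow> nat \<Rightarrow> nat \<Rightarrow> nat \<Rightarrow> nat \<Rightarrow> real" where
  "switched_array n k1 d x y =
    block_array n k1 d x y + real d * (signed_pair 0 1 x * signed_pair (k1 * n + 1) 0 y)"

lemma sum_lessThan_add:
  fixes h :: "nat \<Rightarrow> 'a::comm_monoid_add"
  shows "(\<Sum>y<a + b. h y) = (\<Sum>y<a. h y) + (\<Sum>y<b. h (a + y))"
  by (induction b) (simp_all add: add.assoc)

lemma sum_periodic:
  fixes h :: "nat \<Rightarrow> 'a::semiring_1"
  shows "(\<Sum>y<k * n. h (y mod n)) = of_nat k * (\<Sum>x<n. h x)"
proof (induction k)
  case (Suc k)
  have "(\<Sum>y<Suc k * n. h (y mod n)) = (\<Sum>y<k * n + n. h (y mod n))"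
    by (simp add: add.commute)
  also have "\<dots> = (\<Sum>y<k * n. h (y mod n)) + (\<Sum>x<n. h ((k * n + x) mod n))"
    by (simp add: sum_lessThan_add)
  also have "\<dots> = of_nat (Suc k) * (\<Sum>x<n. h x)"
    using Suc by (simp add: distrib_right add.commute)
  finally show ?case .
qed simp

lemma sum_signed_pair:
  assumes "a < N" "b < N" "a \<noteq> b"
  shows "(\<Sum>z<N. signed_pair a b z) = 0"
proof -
  have "signed_pair a b = (\<lambda>z. (if z = b then 1 else 0) - (if z = a then 1 else 0))"
    using assms by (auto simp: signed_pair_def)
  then show ?thesis
    using assms by (simp add: sum_subtractf)
qed

context
  fixes n m d k1 k2 :: nat
  assumes k1: "k1 \<ge> 1" and m: "m = k1 * n + d" and nd: "n > d" and d: "d > 1"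
    and n: "n = k2 * d"
begin

lemma private_columns_nonempty: "0 < k1 * n"
  using k1 nd by simp

lemma block_row_sum:
  assumes "x < n"
  shows "(\<Sum>y<m. block_array n k1 d x y) = real m"
proof -
  have "(\<Sum>y<m. block_array n k1 d x y) =
      (\<Sum>y<k1 * n. block_array n k1 d x y) + (\<Sum>y<d. block_array n k1 d x (k1 * n + y))"
    unfolding m by (rule sum_lessThan_add)
  also have "(\<Sum>y<k1 * n. block_array n k1 d x y) =
      (\<Sum>y<k1 * n. (\<lambda>z. if z = x then real n else 0) (y mod n))"
    by (intro sum.cong) (auto simp: block_array_def)
  also have "\<dots> = real k1 * real n"
    using assms by (subst sum_periodic) simp
  also have "(\<Sum>y<d. block_array n k1 d x (k1 * n + y)) = real d"
    using d by (simp add: block_array_def)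
  finally show ?thesis
    by (simp add: m)
qed

lemma block_column_sum:
  assumes "y < m"
  shows "(\<Sum>x<n. block_array n k1 d x y) = real n"
proof (cases "y < k1 * n")
  case True
  then show ?thesis
    using nd by (simp add: block_array_def)
next
  case False
  then have "(\<Sum>x<n. block_array n k1 d x y) =
      (\<Sum>x<k2 * d. (\<lambda>z. if z = y - k1 * n then real d else 0) (x mod d))"
    unfolding n[symmetric] by (intro sum.cong) (auto simp: block_array_def)
  also have "\<dots> = real n"
    using assms False by (subst sum_periodic) (auto simp: m n)
  finally show ?thesis .
qed

lemma switched_row_sum:
  assumes "x < n"
  shows "(\<Sum>y<m. switched_array n k1 d x y) = real m"
proof -
  have "(\<Sum>y<m. signed_pair (k1 * n + 1) 0 y) = 0"
    using d by (intro sum_signed_pair) (auto simp: m)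
  then show ?thesis
    using assms by (simp add: switched_array_def sum.distrib block_row_sum flip: sum_distrib_left)
qed

lemma switched_column_sum:
  assumes "y < m"
  shows "(\<Sum>x<n. switched_array n k1 d x y) = real n"
proof -
  have "(\<Sum>x<n. signed_pair 0 1 x) = 0"
    using nd d by (intro sum_signed_pair) auto
  then show ?thesis
    using assms by (simp add: switched_array_def sum.distrib block_column_sum
        flip: sum_distrib_left sum_distrib_right)
qed

lemma switched_nonneg: "0 \<le> switched_array n k1 d x y"
  using private_columns_nonempty nd d
  by (auto simp: switched_array_def block_array_def signed_pair_def)

lemma switched_support:
  "switched_array n k1 d x y \<noteq> 0 \<longleftrightarrow>
    block_array n k1 d x y \<noteq> 0 \<and> (x, y) \<noteq> (1, k1 * n + 1) \<or> (x, y) \<in> {(1, 0), (0, k1 * n + 1)}"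
  using private_columns_nonempty nd d
  by (auto simp: switched_array_def block_array_def signed_pair_def)

text \<open>The support of the switched array is pruned leaf by leaf. Except for column \<open>0\<close>, private columns
  are leaves; without them every row other than row \<open>0\<close> is a leaf, row \<open>1\<close> hanging on column \<open>0\<close>
  and the others on their shared columns. After that only row \<open>0\<close> is left, and its columns are
  leaves.\<close>

lemma switched_rigid:
  fixes D :: "nat \<Rightarrow> nat \<Rightarrow> real"
  assumes supp: "\<And>x y. x < n \<Longrightarrow> y < m \<Longrightarrow> switched_array n k1 d x y = 0 \<Longrightarrow> D x y = 0"
    and row: "\<And>x. x < n \<Longrightarrow> (\<Sum>y<m. D x y) = 0"
    and column: "\<And>y. y < m \<Longrightarrow> (\<Sum>x<n. D x y) = 0"
    and "x < n" "y < m"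
  shows "D x y = 0"
proof -
  have off_support: "D x y = 0"
    if "x < n" "y < m" "block_array n k1 d x y = 0" "(x, y) \<notin> {(1, 0), (0, k1 * n + 1)}" for x y
    using that supp switched_support by blast
  have private_column: "D x y = 0" if "x < n" "0 < y" "y < k1 * n" for x y
  proof (cases "x = y mod n")
    case True
    have "D (y mod n) y = 0"
    proof (rule zero_sum_single_support[where f = "\<lambda>x. D x y"])
      show "(\<Sum>x<n. D x y) = 0"
        using that by (intro column) (simp add: m)
      show "D z y = 0" if "z \<in> {..<n}" "z \<noteq> y mod n" for z
        using that \<open>0 < y\<close> \<open>y < k1 * n\<close>
        by (intro off_support) (auto simp: m block_array_def)
    qed (use nd in auto)
    with True show ?thesis by simp
  next
    case False
    with that show ?thesis
      by (intro off_support) (auto simp: m block_array_def)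
  qed
  have row_ge_1: "D x y = 0" if x: "1 \<le> x" "x < n" and y: "y < m" for x y
  proof -
    define c where "c = (if x = 1 then 0 else k1 * n + x mod d)"
    have others: "D x z = 0" if "z < m" "z \<noteq> c" for z
    proof (cases "0 < z \<and> z < k1 * n")
      case True
      with x show ?thesis by (intro private_column) auto
    next
      case False
      have "block_array n k1 d x z = 0 \<or> (x, z) = (1, k1 * n + 1)"
      proof (cases "z = 0")
        case True
        with x show ?thesis
          using private_columns_nonempty by (simp add: block_array_def)
      next
        case z: False
        have "x mod d = z - k1 * n \<Longrightarrow> x = 1 \<and> z = k1 * n + 1"
          using False z \<open>z \<noteq> c\<close> d by (cases "x = 1") (simp_all add: c_def)
        then show ?thesis
          using False z by (auto simp: block_array_def)
      qed
      moreover have "(x, z) \<notin> {(1, 0), (0, k1 * n + 1)}"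
        using x \<open>z \<noteq> c\<close> by (auto simp: c_def)
      ultimately have "switched_array n k1 d x z = 0"
        using switched_support[of x z] by blast
      with x \<open>z < m\<close> show ?thesis by (intro supp)
    qed
    have "c < m"
      using d by (auto simp: c_def m)
    have "D x c = 0"
      by (rule zero_sum_single_support[where f = "D x", OF _ row[OF x(2)]])
        (use others \<open>c < m\<close> in auto)
    with others y show ?thesis by blast
  qed
  show ?thesis
  proof (cases "x = 0")
    case True
    have "D 0 y = 0"
      by (rule zero_sum_single_support[where f = "\<lambda>x. D x y", OF _ column[OF \<open>y < m\<close>]])
        (use row_ge_1 \<open>y < m\<close> nd in auto)
    with True show ?thesis by simp
  qed (use row_ge_1 assms in auto)
qed

end

section \<open>Arrays indexed by finite types\<close>

text \<open>Enumerations \<open>f\<close> and \<open>g\<close> of the rows and columns carry arrays indexed by numbers over to the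
  given index types.\<close>

definition array_of :: "('n::finite \<Rightarrow> nat) \<Rightarrow> ('m::finite \<Rightarrow> nat) \<Rightarrow> (nat \<Rightarrow> nat \<Rightarrow> real) \<Rightarrow> real ^ 'm ^ 'n"
  where "array_of f g F = (\<chi> i j. F (f i) (g j))"

lemma array_of_doubly_stochastic:
  fixes f :: "'n::finite \<Rightarrow> nat" and g :: "'m::finite \<Rightarrow> nat" and F :: "nat \<Rightarrow> nat \<Rightarrow> real"
  assumes f: "bij_betw f UNIV {..<CARD('n)}" and g: "bij_betw g UNIV {..<CARD('m)}"
    and "\<And>x y. 0 \<le> F x y"
    and "\<And>x. x < CARD('n) \<Longrightarrow> (\<Sum>y<CARD('m). F x y) = CARD('m)"
    and "\<And>y. y < CARD('m) \<Longrightarrow> (\<Sum>x<CARD('n). F x y) = CARD('n)"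
  shows "array_of f g F \<in> doubly_stochastic"
proof -
  have "f i < CARD('n)" "g j < CARD('m)" for i j
    using f g by (auto simp: bij_betw_def)
  moreover have "(\<Sum>i\<in>UNIV. F (f i) y) = (\<Sum>x<CARD('n). F x y)" for y
    by (rule sum.reindex_bij_betw[OF f])
  moreover have "(\<Sum>j\<in>UNIV. F x (g j)) = (\<Sum>y<CARD('m). F x y)" for x
    by (rule sum.reindex_bij_betw[OF g])
  ultimately show ?thesis
    using assms by (simp add: doubly_stochastic_def array_of_def)
qed

lemma ex_enumeration: "\<exists>f. bij_betw f (UNIV :: 'a::finite set) {..<CARD('a)}"
  using ex_bij_betw_finite_nat[of "UNIV :: 'a set"] by (simp add: atLeast0LessThan)

theorem theorem3:
  fixes n m d k1 k2 :: nat
  assumes "CARD('n::finite) = n" and "CARD('m::finite) = m"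
    and "k1 \<ge> 1" and "k2 \<ge> 1"
    and "m = k1 * n + d" and "n > d" and "d > 1" and "n = k2 * d"
  shows "\<exists>M :: real ^ 'm ^ 'n. M extreme_point_of doubly_stochastic \<and> \<not> minimum_array M"
proof -
  note params = assms(3,5-8)
  obtain f :: "'n \<Rightarrow> nat" where f: "bij_betw f UNIV {..<n}"
    using ex_enumeration assms(1) by blast
  obtain g :: "'m \<Rightarrow> nat" where g: "bij_betw g UNIV {..<m}"
    using ex_enumeration assms(2) by blast
  define f' where "f' = inv f"
  define g' where "g' = inv g"
  have f': "bij_betw f' {..<n} UNIV" "\<And>x. x < n \<Longrightarrow> f (f' x) = x" "\<And>i. f' (f i) = i"
    using f unfolding f'_def
    by (auto simp: bij_betw_inv_into bij_betw_inv_into_right bij_betw_inv_into_left)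
  have g': "bij_betw g' {..<m} UNIV" "\<And>y. y < m \<Longrightarrow> g (g' y) = y" "\<And>j. g' (g j) = j"
    using g unfolding g'_def
    by (auto simp: bij_betw_inv_into bij_betw_inv_into_right bij_betw_inv_into_left)
  have fg_less: "f i < n" "g j < m" for i j
    using f g by (auto simp: bij_betw_def)
  define B :: "real ^ 'm ^ 'n" where "B = array_of f g (block_array n k1 d)"
  define M :: "real ^ 'm ^ 'n" where "M = array_of f g (switched_array n k1 d)"
  have B: "B \<in> doubly_stochastic"
    unfolding B_def
    by (rule array_of_doubly_stochastic)
      (use f g assms(1,2) block_row_sum[OF params] block_column_sum[OF params] in
        \<open>auto simp: block_array_def\<close>)
  have M: "M \<in> doubly_stochastic"
    unfolding M_def
    by (rule array_of_doubly_stochastic)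
      (use f g assms(1,2) switched_row_sum[OF params] switched_column_sum[OF params]
        switched_nonneg[OF params] in auto)
  have "M extreme_point_of doubly_stochastic"
  proof (rule extreme_point_if_rigid[OF M])
    fix D :: "real ^ 'm ^ 'n"
    assume supp: "\<And>i j. M $ i $ j = 0 \<Longrightarrow> D $ i $ j = 0"
      and row: "\<And>i. (\<Sum>j\<in>UNIV. D $ i $ j) = 0" and column: "\<And>j. (\<Sum>i\<in>UNIV. D $ i $ j) = 0"
    have zero: "D $ f' x $ g' y = 0" if "x < n" "y < m" for x y
    proof (rule switched_rigid[OF params, where D = "\<lambda>x y. D $ f' x $ g' y"])
      show "D $ f' x $ g' y = 0" if "x < n" "y < m" "switched_array n k1 d x y = 0" for x y
        using that by (intro supp) (simp add: M_def array_of_def f' g')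
      show "(\<Sum>y<m. D $ f' x $ g' y) = 0" for x
        using row sum.reindex_bij_betw[OF g'(1), of "\<lambda>j. D $ f' x $ j"] by simp
      show "(\<Sum>x<n. D $ f' x $ g' y) = 0" for y
        using column sum.reindex_bij_betw[OF f'(1), of "\<lambda>i. D $ i $ g' y"] by simp
    qed (use that in auto)
    have "D $ i $ j = 0" for i j
      using zero[OF fg_less, of i j] by (simp add: f' g')
    then show "D = 0"
      by (simp add: vec_eq_iff)
  qed
  moreover have "\<not> minimum_array M"
  proof -
    define c where "c = k1 * n + 1"
    have less: "0 < n" "1 < n" "0 < m" "c < m"
      using assms(5-7) by (simp_all add: c_def)
    have f_iff: "f i = x \<longleftrightarrow> i = f' x" if "x < n" for i x
      using f'(2)[OF that] f'(3)[of i] by auto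
    have g_iff: "g j = y \<longleftrightarrow> j = g' y" if "y < m" for j y
      using g'(2)[OF that] g'(3)[of j] by auto
    have "M $ i $ j \<noteq> 0 \<longleftrightarrow> B $ i $ j \<noteq> 0 \<and> (i, j) \<noteq> (f' 1, g' c) \<or>
        (i, j) \<in> {(f' 1, g' 0), (f' 0, g' c)}" for i j
      using switched_support[OF params, of "f i" "g j", folded c_def]
      unfolding prod.inject insert_iff empty_iff f_iff[OF less(1)] f_iff[OF less(2)]
        g_iff[OF less(3)] g_iff[OF less(4)]
      by (simp add: M_def B_def array_of_def)
    then have supp_M: "supp M = insert (f' 1, g' 0) (insert (f' 0, g' c) (supp B - {(f' 1, g' c)}))"
      unfolding supp_def by auto
    have "(f' 1, g' c) \<in> supp B" "(f' 1, g' 0) \<notin> supp B" "(f' 0, g' c) \<notin> supp B"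
      using params less by (auto simp: supp_def B_def array_of_def block_array_def f' g' c_def)
    moreover have "f' 1 \<noteq> f' 0"
      using f'(2) less by (metis zero_neq_one)
    ultimately have "card (supp M) = card (supp B) + 1"
      unfolding supp_M using card_Suc_Diff1[of "supp B" "(f' 1, g' c)"] by simp
    with min_supp_le[OF B] show ?thesis
      by (simp add: minimum_array_def)
  qed
  ultimately show ?thesis by blast
qed

end
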